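(* Let $G_1=(V_1,E_1)$ be a $d$-regular graph and let $G_2=(V_2,E_2)$, with $d=|V_2|$. If the neighborhood graph $\mathcal{N}$ of $G_2$ is connected, then $G_1\circ_z G_2$ is connected as well.
   Context: $G_1$ is a finite connected $d$-regular bi-labelled graph and $G_2$ a finite connected regular bi-labelled graph with $|V_2|=d$ (identified with $[d]=\{1,\dots,d\}$). Bi-labelling: at each vertex the incident edges get distinct colors, encoded by a rotation map $\operatorname{Rot}_G(v,h)=(w,k)$ meaning an edge joining $v$ and $w$ colored $h$ near $v$ and $k$ near $w$. The zig-zag product $G_1\circ_z G_2$ has vertex set $V_1\times V_2$ and rotation map $\operatorname{Rot}((v,k),(i,j))=((w,l),(j',i'))$ whenever $\operatorname{Rot}_{G_2}(k,i)=(k',i')$, $\operatorname{Rot}_{G_1}(v,k')=(w,l')$, $\operatorname{Rot}_{G_2}(l',j)=(l,j')$. For $h\in V_2$ let $N_h=\{h'\in V_2: h\sim h'\}$. The neighborhood graph $\mathcal{N}=(\mathcal{V},\mathcal{E})$ of $G_2$ has vertex set $\mathcal{V}=\{N_h: h\in V_2\}$ and edge set $\mathcal{E}=\{\{N_h,N_k\}: N_h\cap N_k\neq\emptyset,\ h\neq k\}$, i.e. $N_h,N_k$ are adjacent iff $h\ne k$ have a common neighbor in $G_2$.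
   Formalization: The degree of G_2 is assumed to be at least 1; this excludes only G_2 = a single vertex without edges (d = 1), where the claim fails: for G_1 = K_2 the neighborhood graph is one vertex, hence connected, but the zig-zag product is two isolated vertices. *)

theory Defs
  imports "Graph_Theory.Graph_Theory"
begin

text \<open>
  A bi-labelled regular multigraph is given by its vertices, its colours and its rotation map:
  \<open>rot G (v, h) = (w, k)\<close> says that an edge joining \<open>v\<close> and \<open>w\<close> is coloured \<open>h\<close> near \<open>v\<close> and
  \<open>k\<close> near \<open>w\<close>. The edges are the orbits \<open>{(v, h), rot G (v, h)}\<close>, so loops and parallel edges
  are allowed. Every vertex carries each colour exactly once, so the degree is the number of
  colours.
\<close>

record ('v, 'c) bilabelled =
  vertices :: "'v set"
  colours :: "'c set"
  rot :: "'v \<times> 'c \<Rightarrow> 'v \<times> 'c"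

locale bilabelled_graph =
  fixes G :: "('v, 'c) bilabelled" and d :: nat
  assumes finite_vertices: "finite (vertices G)"
    and finite_colours: "finite (colours G)"
    and degree: "card (colours G) = d"
    and rot_closed: "x \<in> vertices G \<times> colours G \<Longrightarrow> rot G x \<in> vertices G \<times> colours G"
    and rot_rot: "x \<in> vertices G \<times> colours G \<Longrightarrow> rot G (rot G x) = x"

text \<open>
  The underlying multigraph as a symmetric digraph: each pair of a vertex and a colour is an arc
  leaving that vertex, and its reverse is its image under the rotation map.
\<close>

definition graph_of :: "('v, 'c) bilabelled \<Rightarrow> ('v, 'v \<times> 'c) pre_digraph" where
  "graph_of G = \<lparr> verts = vertices G, arcs = vertices G \<times> colours G,
                  tail = fst, head = (\<lambda>x. fst (rot G x)) \<rparr>"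

lemma (in bilabelled_graph) pseudo_graph_graph_of: "pseudo_graph (graph_of G)"
proof
  fix e assume e: "e \<in> arcs (graph_of G)"
  then show "tail (graph_of G) e \<in> verts (graph_of G)"
    by (auto simp: graph_of_def)
  from e rot_closed[of e] show "head (graph_of G) e \<in> verts (graph_of G)"
    by (auto simp: graph_of_def mem_Times_iff)
next
  show "finite (verts (graph_of G))" "finite (arcs (graph_of G))"
    using finite_vertices finite_colours by (auto simp: graph_of_def)
next
  show "symmetric (graph_of G)"
    unfolding symmetric_def
  proof (rule symI)
    fix u v assume "u \<rightarrow>\<^bsub>graph_of G\<^esub> v"
    then obtain x where x: "x \<in> vertices G \<times> colours G" "u = fst x" "v = fst (rot G x)"
      by (auto simp: arcs_ends_def arc_to_ends_def graph_of_def)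
    with rot_closed[of x] rot_rot[of x] show "v \<rightarrow>\<^bsub>graph_of G\<^esub> u"
      by (auto simp: arcs_ends_def arc_to_ends_def graph_of_def intro!: image_eqI[of _ _ "rot G x"])
  qed
qed

text \<open>
  The zig-zag product is meaningful when the colours of \<open>G1\<close> are the vertices of \<open>G2\<close>.
\<close>

definition zigzag ::
  "('a, 'b) bilabelled \<Rightarrow> ('b, 'c) bilabelled \<Rightarrow> ('a \<times> 'b, 'c \<times> 'c) bilabelled" where
  "zigzag G1 G2 =
     \<lparr> vertices = vertices G1 \<times> vertices G2,
       colours = colours G2 \<times> colours G2,
       rot = (\<lambda>((v, k), (i, j)).
                let (k', i') = rot G2 (k, i);
                    (w, l') = rot G1 (v, k');
                    (l, j') = rot G2 (l', j)
                in ((w, l), (j', i'))) \<rparr>"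

lemma bilabelled_graph_zigzag:
  assumes "bilabelled_graph G1 d" "bilabelled_graph G2 e" "colours G1 = vertices G2"
  shows "bilabelled_graph (zigzag G1 G2) (e\<^sup>2)"
proof -
  interpret G1: bilabelled_graph G1 d by fact
  interpret G2: bilabelled_graph G2 e by fact
  have *: "rot (zigzag G1 G2) x \<in> vertices (zigzag G1 G2) \<times> colours (zigzag G1 G2) \<and>
      rot (zigzag G1 G2) (rot (zigzag G1 G2) x) = x"
    if "x \<in> vertices (zigzag G1 G2) \<times> colours (zigzag G1 G2)" for x
  proof -
    obtain v k i j where x: "x = ((v, k), (i, j))" by (metis surj_pair)
    obtain k' i' where r1: "rot G2 (k, i) = (k', i')" by (metis surj_pair)
    obtain w l' where r2: "rot G1 (v, k') = (w, l')" by (metis surj_pair)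
    obtain l j' where r3: "rot G2 (l', j) = (l, j')" by (metis surj_pair)
    have m: "v \<in> vertices G1" "k \<in> vertices G2" "i \<in> colours G2" "j \<in> colours G2"
      using that x by (auto simp: zigzag_def)
    have m1: "k' \<in> vertices G2" "i' \<in> colours G2" "rot G2 (k', i') = (k, i)"
      using G2.rot_closed[of "(k, i)"] G2.rot_rot[of "(k, i)"] m r1 by auto
    have m2: "w \<in> vertices G1" "l' \<in> vertices G2" "rot G1 (w, l') = (v, k')"
      using G1.rot_closed[of "(v, k')"] G1.rot_rot[of "(v, k')"] m m1 r2 assms(3) by auto
    have m3: "l \<in> vertices G2" "j' \<in> colours G2" "rot G2 (l, j') = (l', j)"
      using G2.rot_closed[of "(l', j)"] G2.rot_rot[of "(l', j)"] m m2 r3 by auto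
    show ?thesis
      using m m1 m2 m3 r1 r2 r3 by (simp add: x zigzag_def)
  qed
  show ?thesis
    by unfold_locales
      (use * in \<open>auto simp: zigzag_def G1.finite_vertices G2.finite_vertices G2.finite_colours
         card_cartesian_product G2.degree power2_eq_square\<close>)
qed

definition nbhd :: "('v, 'c) bilabelled \<Rightarrow> 'v \<Rightarrow> 'v set" where
  "nbhd G h = {h' \<in> vertices G. h \<rightarrow>\<^bsub>graph_of G\<^esub> h'}"

text \<open>
  The vertices are the sets \<open>N\<^sub>h\<close> themselves, so distinct \<open>h\<close>, \<open>k\<close> with \<open>N\<^sub>h = N\<^sub>k\<close> give one vertex.
  Each undirected edge \<open>{N\<^sub>h, N\<^sub>k}\<close> appears as the two arcs \<open>(N\<^sub>h, N\<^sub>k)\<close> and \<open>(N\<^sub>k, N\<^sub>h)\<close>.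
\<close>

definition neighborhood_graph :: "('v, 'c) bilabelled \<Rightarrow> 'v set pair_pre_digraph" where
  "neighborhood_graph G =
     \<lparr> pverts = nbhd G ` vertices G,
       parcs = {(nbhd G h, nbhd G k) | h k.
                  h \<in> vertices G \<and> k \<in> vertices G \<and> nbhd G h \<inter> nbhd G k \<noteq> {} \<and> h \<noteq> k} \<rparr>"

end

theory Submission
  imports Defs
begin

text \<open>
  If \<open>h\<close> and \<open>k\<close> have a common neighbor \<open>m\<close> in \<open>G\<^sub>2\<close>, then \<open>(v, h)\<close> and \<open>(v, k)\<close> have a common
  neighbor in the zig-zag product: both can make the first \<open>G\<^sub>2\<close>-step to \<open>m\<close> and continue
  identically from there. Connectedness of the neighborhood graph therefore puts each fiber
  \<open>{v} \<times> V\<^sub>2\<close> inside one component, and every edge of \<open>G\<^sub>1\<close> lies under an edge of the product, so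
  the fibers are joined to each other along paths of \<open>G\<^sub>1\<close>. Both halves are instances of one
  principle: if each fiber over a connected graph lies in one component and adjacent fibers are
  linked, then all fibers lie in the same component.
\<close>

lemma connected_induct [consumes 3, case_names base step]:
  assumes "Digraph_Component.connected G" "u \<in> verts G" "v \<in> verts G"
    and base: "P u"
    and adjacent: "\<And>x y. \<lbrakk>x \<in> verts G; y \<in> verts G; x \<rightarrow>\<^bsub>G\<^esub> y \<or> y \<rightarrow>\<^bsub>G\<^esub> x; P x\<rbrakk> \<Longrightarrow> P y"
  shows "P v"
proof -
  have "u \<rightarrow>\<^sup>*\<^bsub>with_proj (mk_symmetric G)\<^esub> v"
    using assms(1-3) by (auto simp: connected_def)
  then show ?thesis
    unfolding reachable_def
  proof (induction rule: rtrancl_on_induct)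
    case base
    show ?case by fact
  next
    case (step x y)
    then have "x \<rightarrow>\<^bsub>G\<^esub> y \<or> y \<rightarrow>\<^bsub>G\<^esub> x"
      by (auto simp: parcs_mk_symmetric arcs_ends_conv)
    with step show ?case
      by (auto intro: adjacent[of x y])
  qed
qed

lemma (in wf_digraph) strongly_connected_imp_connected:
  "strongly_connected G \<Longrightarrow> Digraph_Component.connected G"
  by (auto simp: connected_def strongly_connected_def intro: reachable_mk_symmetricI)

lemma (in sym_digraph) reachable_between_fibers:
  assumes B: "Digraph_Component.connected B" "u \<in> verts B" "v \<in> verts B"
    and a: "a \<in> F u" and b: "b \<in> F v"
    and within: "\<And>x p q. \<lbrakk>x \<in> verts B; p \<in> F x; q \<in> F x\<rbrakk> \<Longrightarrow> p \<rightarrow>\<^sup>* q"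
    and across: "\<And>x y. \<lbrakk>x \<in> verts B; y \<in> verts B; x \<rightarrow>\<^bsub>B\<^esub> y\<rbrakk> \<Longrightarrow> \<exists>p\<in>F x. \<exists>q\<in>F y. p \<rightarrow>\<^sup>* q"
  shows "a \<rightarrow>\<^sup>* b"
proof -
  from B have "\<forall>q\<in>F v. a \<rightarrow>\<^sup>* q"
  proof (induction rule: connected_induct)
    case base
    show ?case using within B(2) a by blast
  next
    case (step x y)
    then have "\<exists>p\<in>F x. \<exists>q\<in>F y. p \<rightarrow>\<^sup>* q"
      using across[of x y] across[of y x] symmetric_reachable' by blast
    then obtain p q where link: "p \<in> F x" "q \<in> F y" "p \<rightarrow>\<^sup>* q"
      by blast
    show ?case
    proof
      fix r assume r: "r \<in> F y"
      have "a \<rightarrow>\<^sup>* p" using step link by blast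
      also note \<open>p \<rightarrow>\<^sup>* q\<close>
      also have "q \<rightarrow>\<^sup>* r" using within step link r by blast
      finally show "a \<rightarrow>\<^sup>* r" .
    qed
  qed
  with b show ?thesis by blast
qed

lemma verts_graph_of [simp]: "verts (graph_of G) = vertices G"
  by (simp add: graph_of_def)

lemma vertices_zigzag [simp]: "vertices (zigzag G1 G2) = vertices G1 \<times> vertices G2"
  by (simp add: zigzag_def)

lemma dominates_graph_of_iff:
  "u \<rightarrow>\<^bsub>graph_of G\<^esub> v \<longleftrightarrow> u \<in> vertices G \<and> (\<exists>c\<in>colours G. \<exists>c'. rot G (u, c) = (v, c'))"
  by (force simp: arcs_ends_def arc_to_ends_def graph_of_def prod_eq_iff)

lemma dominates_neighborhood_graph_iff:
  "M \<rightarrow>\<^bsub>with_proj (neighborhood_graph G)\<^esub> N \<longleftrightarrow>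
    (\<exists>h\<in>vertices G. \<exists>k\<in>vertices G. M = nbhd G h \<and> N = nbhd G k \<and> M \<inter> N \<noteq> {} \<and> h \<noteq> k)"
  by (auto simp: neighborhood_graph_def)

lemma dominates_zigzag:
  assumes "v \<in> vertices G1" "k \<rightarrow>\<^bsub>graph_of G2\<^esub> k'" "rot G1 (v, k') = (w, l')" "l' \<rightarrow>\<^bsub>graph_of G2\<^esub> l"
  shows "(v, k) \<rightarrow>\<^bsub>graph_of (zigzag G1 G2)\<^esub> (w, l)"
proof -
  obtain i i' where i: "k \<in> vertices G2" "i \<in> colours G2" "rot G2 (k, i) = (k', i')"
    using assms(2) by (auto simp: dominates_graph_of_iff)
  obtain j j' where j: "j \<in> colours G2" "rot G2 (l', j) = (l, j')"
    using assms(4) by (auto simp: dominates_graph_of_iff)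
  have "rot (zigzag G1 G2) ((v, k), (i, j)) = ((w, l), (j', i'))"
    using i j assms(3) by (simp add: zigzag_def)
  moreover have "(i, j) \<in> colours (zigzag G1 G2)"
    using i j by (simp add: zigzag_def)
  ultimately show ?thesis
    using i assms(1) by (auto simp: dominates_graph_of_iff)
qed

context bilabelled_graph
begin

sublocale graph: pseudo_graph "graph_of G"
  by (rule pseudo_graph_graph_of)

lemma mem_nbhd_iff: "k \<in> nbhd G h \<longleftrightarrow> h \<rightarrow>\<^bsub>graph_of G\<^esub> k"
  using graph.adj_in_verts(2) by (auto simp: nbhd_def)

lemma ex_dominates:
  assumes "0 < d" "h \<in> vertices G"
  shows "\<exists>k. h \<rightarrow>\<^bsub>graph_of G\<^esub> k"
proof -
  obtain c where "c \<in> colours G"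
    using degree assms(1) by fastforce
  moreover obtain k c' where "rot G (h, c) = (k, c')"
    by (rule prod.exhaust)
  ultimately show ?thesis
    using assms(2) by (auto simp: dominates_graph_of_iff)
qed

lemma rot_colour_closed:
  assumes "rot G (v, c) = (w, c')" "v \<in> vertices G" "c \<in> colours G"
  shows "c' \<in> colours G"
  using rot_closed[of "(v, c)"] assms by simp

end

locale zigzag_factors =
  G1: bilabelled_graph G1 d + G2: bilabelled_graph G2 e
  for G1 :: "('a, 'b) bilabelled" and G2 :: "('b, 'c) bilabelled" and d e +
  assumes colours_eq: "colours G1 = vertices G2" and e_pos: "0 < e"
begin

abbreviation "Z \<equiv> graph_of (zigzag G1 G2)"

sublocale zigzag: bilabelled_graph "zigzag G1 G2" "e\<^sup>2"
  using G1.bilabelled_graph_axioms G2.bilabelled_graph_axioms colours_eq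
  by (rule bilabelled_graph_zigzag)

lemma reachable_if_common_neighbor:
  assumes v: "v \<in> vertices G1" and "nbhd G2 h \<inter> nbhd G2 k \<noteq> {}"
  shows "(v, h) \<rightarrow>\<^sup>*\<^bsub>Z\<^esub> (v, k)"
proof -
  obtain m where m: "h \<rightarrow>\<^bsub>graph_of G2\<^esub> m" "k \<rightarrow>\<^bsub>graph_of G2\<^esub> m"
    using assms(2) by (auto simp: G2.mem_nbhd_iff)
  then have "m \<in> colours G1"
    using G2.graph.adj_in_verts(2) by (auto simp: colours_eq)
  obtain w l' where r: "rot G1 (v, m) = (w, l')"
    by (rule prod.exhaust)
  have "l' \<in> vertices G2"
    using G1.rot_colour_closed[OF r v \<open>m \<in> colours G1\<close>] by (simp add: colours_eq)
  then obtain l where l: "l' \<rightarrow>\<^bsub>graph_of G2\<^esub> l"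
    using G2.ex_dominates[OF e_pos] by blast
  have "(v, h) \<rightarrow>\<^bsub>Z\<^esub> (w, l)"
    using v m(1) r l by (rule dominates_zigzag)
  also have "(w, l) \<rightarrow>\<^bsub>Z\<^esub> (v, k)"
    using zigzag.graph.sym_arcs dominates_zigzag[OF v m(2) r l] by (rule arcs_ends_symmetric)
  finally show ?thesis
    by (rule zigzag.graph.reachable1_reachable)
qed

lemma reachable_in_fiber:
  assumes conn: "Digraph_Component.connected (with_proj (neighborhood_graph G2))"
    and v: "v \<in> vertices G1" and h: "h \<in> vertices G2" and k: "k \<in> vertices G2"
  shows "(v, h) \<rightarrow>\<^sup>*\<^bsub>Z\<^esub> (v, k)"
proof -
  define F where "F N = {v} \<times> {x \<in> vertices G2. nbhd G2 x = N}" for N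
  show ?thesis
  proof (rule zigzag.graph.reachable_between_fibers[OF conn, of "nbhd G2 h" "nbhd G2 k" _ F])
    show "p \<rightarrow>\<^sup>*\<^bsub>Z\<^esub> q" if pq: "p \<in> F N" "q \<in> F N" for N p q
    proof -
      obtain x y where xy: "p = (v, x)" "q = (v, y)" "x \<in> vertices G2"
        "nbhd G2 x = N" "nbhd G2 y = N"
        using pq by (auto simp: F_def)
      moreover from xy have "nbhd G2 x \<noteq> {}"
        using G2.ex_dominates[OF e_pos] G2.mem_nbhd_iff by blast
      ultimately show ?thesis
        using reachable_if_common_neighbor[OF v, of x y] by simp
    qed
  next
    show "\<exists>p\<in>F M. \<exists>q\<in>F N. p \<rightarrow>\<^sup>*\<^bsub>Z\<^esub> q"
      if MN: "M \<rightarrow>\<^bsub>with_proj (neighborhood_graph G2)\<^esub> N" for M N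
    proof -
      obtain x y where "x \<in> vertices G2" "y \<in> vertices G2" "M = nbhd G2 x" "N = nbhd G2 y"
          "nbhd G2 x \<inter> nbhd G2 y \<noteq> {}"
        using MN unfolding dominates_neighborhood_graph_iff by blast
      then have "(v, x) \<in> F M" "(v, y) \<in> F N" "(v, x) \<rightarrow>\<^sup>*\<^bsub>Z\<^esub> (v, y)"
        using reachable_if_common_neighbor[OF v] by (auto simp: F_def)
      then show ?thesis by blast
    qed
  qed (use h k in \<open>auto simp: F_def neighborhood_graph_def\<close>)
qed

lemma ex_dominates_zigzag:
  assumes xy: "x \<rightarrow>\<^bsub>graph_of G1\<^esub> y"
  shows "\<exists>h\<in>vertices G2. \<exists>k\<in>vertices G2. (x, h) \<rightarrow>\<^bsub>Z\<^esub> (y, k)"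
proof -
  obtain c c' where x: "x \<in> vertices G1" and c: "c \<in> vertices G2" and r: "rot G1 (x, c) = (y, c')"
    using xy by (auto simp: dominates_graph_of_iff colours_eq)
  have c': "c' \<in> vertices G2"
    using G1.rot_colour_closed[OF r x] c by (simp add: colours_eq)
  obtain h where "c \<rightarrow>\<^bsub>graph_of G2\<^esub> h"
    using G2.ex_dominates[OF e_pos c] by blast
  then have h: "h \<rightarrow>\<^bsub>graph_of G2\<^esub> c"
    by (rule arcs_ends_symmetric[OF G2.graph.sym_arcs])
  obtain k where k: "c' \<rightarrow>\<^bsub>graph_of G2\<^esub> k"
    using G2.ex_dominates[OF e_pos c'] by blast
  have "(x, h) \<rightarrow>\<^bsub>Z\<^esub> (y, k)"
    using x h r k by (rule dominates_zigzag)
  then show ?thesis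
    using G2.graph.adj_in_verts[OF h] G2.graph.adj_in_verts[OF k] by auto
qed

lemma connected_zigzag:
  assumes conn1: "Digraph_Component.connected (graph_of G1)"
    and connN: "Digraph_Component.connected (with_proj (neighborhood_graph G2))"
  shows "Digraph_Component.connected Z"
proof -
  have "(u, h) \<rightarrow>\<^sup>*\<^bsub>Z\<^esub> (v, k)"
    if "u \<in> vertices G1" "v \<in> vertices G1" "h \<in> vertices G2" "k \<in> vertices G2" for u v h k
  proof (rule zigzag.graph.reachable_between_fibers[OF conn1, of u v _ "\<lambda>x. {x} \<times> vertices G2"])
    fix x p q
    assume "x \<in> verts (graph_of G1)" "p \<in> {x} \<times> vertices G2" "q \<in> {x} \<times> vertices G2"
    then show "p \<rightarrow>\<^sup>*\<^bsub>Z\<^esub> q"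
      using reachable_in_fiber[OF connN] by auto
  next
    fix x y assume "x \<rightarrow>\<^bsub>graph_of G1\<^esub> y"
    then obtain h k where "h \<in> vertices G2" "k \<in> vertices G2" "(x, h) \<rightarrow>\<^bsub>Z\<^esub> (y, k)"
      using ex_dominates_zigzag by blast
    then show "\<exists>p\<in>{x} \<times> vertices G2. \<exists>q\<in>{y} \<times> vertices G2. p \<rightarrow>\<^sup>*\<^bsub>Z\<^esub> q"
      by (intro bexI[of _ "(x, h)"] bexI[of _ "(y, k)"]) auto
  qed (use that in auto)
  moreover have "vertices G1 \<noteq> {}" "vertices G2 \<noteq> {}"
    using assms by (auto simp: connected_def strongly_connected_def neighborhood_graph_def)
  ultimately have "strongly_connected Z"
    by (auto simp: strongly_connected_def)
  then show ?thesis
    by (rule zigzag.graph.strongly_connected_imp_connected)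
qed

end

theorem theorem3p1:
  fixes G1 :: "('a, 'b) bilabelled" and G2 :: "('b, 'c) bilabelled" and d e :: nat
  assumes "bilabelled_graph G1 d"
    and "Digraph_Component.connected (graph_of G1)"
    and "bilabelled_graph G2 e" and "0 < e"
    and "Digraph_Component.connected (graph_of G2)"
    and "card (vertices G2) = d" and "colours G1 = vertices G2"
    and "Digraph_Component.connected (with_proj (neighborhood_graph G2))"
  shows "Digraph_Component.connected (graph_of (zigzag G1 G2))"
proof -
  interpret zigzag_factors G1 G2 d e
    using assms by (simp add: zigzag_factors_def zigzag_factors_axioms_def)
  show ?thesis
    using assms(2,8) by (rule connected_zigzag)
qed

end
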